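(* Let $H=(\square_i P_{n_i})\square(\square_j C_{m_j})$ be a finite Cartesian product of paths $P_{n_i}$ ($n_i\ge1$) and cycles $C_{m_j}$ ($m_j\ge3$). Then: (a) $\gamma(H)=\prod_i\gamma(P_{n_i})\prod_j\gamma(C_{m_j})$; in particular $\gamma(\square_i P_{n_i})=\prod_i(2^{n_i}-1)$ and $\gamma(\square_i C_{m_i})=\prod_i\bigl(2^{r_{m_i}}+2^{m_i-r_{m_i}+1}-3\bigr)$ where $r_{m_i}=\lceil m_i/2\rceil$; (b) $\gamma(H\square T)=\gamma(H)\gamma(T)$ for any tree $T$; (c) $\gamma(H\square K_n)=\gamma(H)\gamma(K_n)$ for the complete graph $K_n$.
   Context: All graphs are finite and connected; $P_n$ is the path on $n$ vertices, $C_m$ the cycle on $m$ vertices, $K_n$ the complete graph on $n$ vertices. A pebbling step removes two pebbles from a vertex and places one pebble on an adjacent vertex. The cover pebbling number $\gamma(G)$ is the minimum $N$ such that for every placement of $N$ pebbles on $G$ some sequence of pebbling steps leaves at least one pebble on every vertex. $G\square H$ is the Cartesian product: vertex set $V(G)\times V(H)$, with $(w,v)\sim(w',v')$ iff ($w=w'$ and $v\sim v'$) or ($v=v'$ and $w\sim w'$). *)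

theory Defs
  imports Complex_Main "Graph_Theory.Graph_Theory"
begin

text \<open>
  A finite simple graph is a \<^locale>\<open>pair_graph\<close>: every undirected edge is represented
  by its two arcs.
\<close>

definition path_graph :: "nat \<Rightarrow> nat pair_pre_digraph" where
  "path_graph n = \<lparr> pverts = {..<n},
     parcs = {(u, v). u < n \<and> v < n \<and> (v = Suc u \<or> u = Suc v)} \<rparr>"

text \<open>For \<open>m < 3\<close> this is not the usual cycle; it is only used for \<open>m \<ge> 3\<close>.\<close>

definition cycle_graph :: "nat \<Rightarrow> nat pair_pre_digraph" where
  "cycle_graph m = \<lparr> pverts = {..<m},
     parcs = {(u, v). u < m \<and> v < m \<and> (v = Suc u mod m \<or> u = Suc v mod m)} \<rparr>"

text \<open>
  The library predicate \<^const>\<open>tree\<close> cannot be used: it forbids directed cycles, and in a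
  symmetric digraph every edge gives the directed cycle \<open>u, v, u\<close>.  In a loop-free graph
  without parallel arcs, the cycles of the undirected graph are exactly the directed cycles
  with at least three arcs.  Connectedness includes having a vertex.
\<close>

definition tree_graph :: "'a pair_pre_digraph \<Rightarrow> bool" where
  "tree_graph T \<longleftrightarrow> pair_graph T \<and> Digraph_Component.connected (with_proj T) \<and>
     \<not> (\<exists>p. pre_digraph.cycle (with_proj T) p \<and> 3 \<le> length p)"

definition cartesian_product ::
  "'a pair_pre_digraph \<Rightarrow> 'b pair_pre_digraph \<Rightarrow> ('a \<times> 'b) pair_pre_digraph"
  (infixr \<open>\<box>\<close> 70) where
  "G \<box> H = \<lparr> pverts = pverts G \<times> pverts H,
     parcs = {((w, v), (w', v')).
       w = w' \<and> w \<in> pverts G \<and> (v, v') \<in> parcs H \<or>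
       v = v' \<and> v \<in> pverts H \<and> (w, w') \<in> parcs G} \<rparr>"

definition relabel :: "('a \<Rightarrow> 'b) \<Rightarrow> 'a pair_pre_digraph \<Rightarrow> 'b pair_pre_digraph" where
  "relabel f G = \<lparr> pverts = f ` pverts G, parcs = map_prod f f ` parcs G \<rparr>"

text \<open>
  Iterated Cartesian product of a list of graphs; the tuples \<open>(x\<^sub>1, (x\<^sub>2, \<dots>))\<close> of the binary
  products are written as lists.  The empty product is the one-vertex graph.
\<close>

primrec cartesian_product_list :: "'a pair_pre_digraph list \<Rightarrow> 'a list pair_pre_digraph" where
  "cartesian_product_list [] = \<lparr> pverts = {[]}, parcs = {} \<rparr>"
| "cartesian_product_list (G # Gs) =
     relabel (\<lambda>(x, xs). x # xs) (G \<box> cartesian_product_list Gs)"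

definition placement :: "'a pair_pre_digraph \<Rightarrow> nat \<Rightarrow> ('a \<Rightarrow> nat) \<Rightarrow> bool" where
  "placement G N p \<longleftrightarrow> (\<forall>v. v \<notin> pverts G \<longrightarrow> p v = 0) \<and> (\<Sum>v\<in>pverts G. p v) = N"

definition pebbling_step :: "'a pair_pre_digraph \<Rightarrow> ('a \<Rightarrow> nat) \<Rightarrow> ('a \<Rightarrow> nat) \<Rightarrow> bool" where
  "pebbling_step G p q \<longleftrightarrow>
     (\<exists>u v. (u, v) \<in> parcs G \<and> 2 \<le> p u \<and> q = p(u := p u - 2, v := p v + 1))"

definition cover_pebbling_number :: "'a pair_pre_digraph \<Rightarrow> nat" where
  "cover_pebbling_number G = (LEAST N. \<forall>p. placement G N p \<longrightarrow>
     (\<exists>q. (pebbling_step G)\<^sup>*\<^sup>* p q \<and> (\<forall>v\<in>pverts G. 1 \<le> q v)))"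

end

theory Submission
  imports Defs
begin

text \<open>
  For every connected graph \<open>G\<close> the worst placements are the stacks on a single vertex:
  \<open>\<gamma>(G) = Max\<^sub>v (\<Sum>u. 2 ^ d(v, u))\<close> (the cover pebbling theorem).  Since distances add up in a
  Cartesian product, the right-hand side, and hence \<open>\<gamma>\<close>, is multiplicative.

  For a stack on \<open>v\<close> the weight \<open>\<Sum>u. q(u) 2 ^ d(v, u)\<close> never increases, so it bounds the number
  of pebbles from below.  Conversely let \<open>R\<close> be the set of vertices carrying at least two pebbles,
  and let \<open>W\<^sub>R(q) = \<Sum>u. q(u) 2 ^ d(R, u)\<close>.  As long as a vertex is empty, send a pebble from
  \<open>R\<close> along a shortest path to an empty vertex closest to \<open>R\<close>.  This preserves \<open>W\<^sub>R\<close>, and no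
  new vertex enters \<open>R\<close>; when \<open>R\<close> shrinks, \<open>W\<^sub>R\<close> can only grow.  If \<open>R\<close> were to run empty before
  everything is covered, the last \<open>r \<in> R\<close> would give
  \<open>\<Sum>u. q(u) 2 ^ d(r, u) < \<Sum>u. 2 ^ d(r, u)\<close>, although the weight was at least the initial
  number of pebbles.
\<close>

section \<open>Distances from a vertex set, described by level functions\<close>

text \<open>A local characterization of \<open>h u = d(R, u)\<close>. For products, paths and cycles
  a formula for the distance can then be checked arc by arc, without handling walks.\<close>

definition bfs_level :: "'a pair_pre_digraph \<Rightarrow> 'a set \<Rightarrow> ('a \<Rightarrow> nat) \<Rightarrow> bool" where
  "bfs_level G R h \<longleftrightarrow>
     (\<forall>u\<in>pverts G. h u = 0 \<longleftrightarrow> u \<in> R) \<and>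
     (\<forall>u w. (u, w) \<in> parcs G \<longrightarrow> h w \<le> Suc (h u)) \<and>
     (\<forall>w\<in>pverts G. h w \<noteq> 0 \<longrightarrow> (\<exists>u\<in>pverts G. (u, w) \<in> parcs G \<and> h w = Suc (h u)))"

lemma bfs_levelD:
  assumes "bfs_level G R h"
  shows bfs_level_zero: "u \<in> pverts G \<Longrightarrow> h u = 0 \<longleftrightarrow> u \<in> R"
    and bfs_level_step: "(u, w) \<in> parcs G \<Longrightarrow> h w \<le> Suc (h u)"
    and bfs_level_pred:
      "w \<in> pverts G \<Longrightarrow> h w \<noteq> 0 \<Longrightarrow> \<exists>u\<in>pverts G. (u, w) \<in> parcs G \<and> h w = Suc (h u)"
  using assms unfolding bfs_level_def by auto

text \<open>Descending along predecessors for \<open>h'\<close> reaches \<open>R'\<close>, hence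
  \<open>R\<close>, after \<open>h' u\<close> arcs, and \<open>h\<close> rises by at most one on
  each of them. Taking \<open>R = R'\<close> in both directions makes level functions unique, so any
  one that is found is the distance.\<close>

lemma bfs_level_antimono:
  assumes "bfs_level G R h" "bfs_level G R' h'" "R' \<subseteq> R" "u \<in> pverts G"
  shows "h u \<le> h' u"
  using \<open>u \<in> pverts G\<close>
proof (induction "h' u" arbitrary: u)
  case 0
  then show ?case using assms(1-3) by (metis bfs_level_zero le_refl subsetD)
next
  case (Suc k)
  then obtain w where w: "w \<in> pverts G" "(w, u) \<in> parcs G" "h' u = Suc (h' w)"
    using bfs_level_pred[OF assms(2)] by (metis nat.distinct(1))
  with Suc have "h w \<le> h' w" by simp
  then show ?case using bfs_level_step[OF assms(1) w(2)] w(3) by simp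
qed

corollary bfs_level_unique:
  assumes "bfs_level G R h" "bfs_level G R h'" "u \<in> pverts G"
  shows "h u = h' u"
  using bfs_level_antimono[OF assms(1,2) order.refl assms(3)]
    bfs_level_antimono[OF assms(2,1) order.refl assms(3)] by simp

text \<open>Arbitrary at vertices that cannot be reached from \<open>R\<close>.\<close>

definition dist_from :: "'a pair_pre_digraph \<Rightarrow> 'a set \<Rightarrow> 'a \<Rightarrow> nat" where
  "dist_from G R u = (LEAST k. \<exists>r\<in>R. (r, u) \<in> parcs G ^^ k)"

text \<open>Bringing one pebble from \<open>v\<close> to distance \<open>d\<close> uses up
  \<open>2 ^ d\<close> pebbles, so this is the price of covering \<open>G\<close> from a stack on
  \<open>v\<close>.\<close>

definition stacking_cost :: "'a pair_pre_digraph \<Rightarrow> 'a \<Rightarrow> nat" where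
  "stacking_cost G v = (\<Sum>u\<in>pverts G. 2 ^ dist_from G {v} u)"

definition weight :: "'a pair_pre_digraph \<Rightarrow> 'a set \<Rightarrow> ('a \<Rightarrow> nat) \<Rightarrow> nat" where
  "weight G R q = (\<Sum>u\<in>pverts G. q u * 2 ^ dist_from G R u)"

locale connected_graph =
  fixes G :: "'a pair_pre_digraph"
  assumes finite_verts: "finite (pverts G)"
    and verts_nonempty: "pverts G \<noteq> {}"
    and arcs_wf: "(u, v) \<in> parcs G \<Longrightarrow> u \<in> pverts G \<and> v \<in> pverts G"
    and loopfree: "(u, v) \<in> parcs G \<Longrightarrow> u \<noteq> v"
    and reachable: "u \<in> pverts G \<Longrightarrow> v \<in> pverts G \<Longrightarrow> (u, v) \<in> (parcs G)\<^sup>*"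

text \<open>Following predecessors from \<open>w\<close> down to level 0 traces a walk from
  \<open>v\<close> to \<open>w\<close>. One level function thus yields both connectedness and
  distances.\<close>

lemma connected_graphI_bfs:
  assumes "finite (pverts G)" "pverts G \<noteq> {}"
    and "\<And>u v. (u, v) \<in> parcs G \<Longrightarrow> u \<in> pverts G \<and> v \<in> pverts G \<and> u \<noteq> v"
    and level: "\<And>v. v \<in> pverts G \<Longrightarrow> \<exists>h. bfs_level G {v} h"
  shows "connected_graph G"
proof
  fix v w assume v: "v \<in> pverts G" and "w \<in> pverts G"
  from level[OF v] obtain h where h: "bfs_level G {v} h" ..
  show "(v, w) \<in> (parcs G)\<^sup>*"
    using \<open>w \<in> pverts G\<close>
  proof (induction "h w" arbitrary: w)
    case 0
    then show ?case using bfs_level_zero[OF h] by simp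
  next
    case (Suc k)
    then obtain u where "u \<in> pverts G" "(u, w) \<in> parcs G" "h w = Suc (h u)"
      using bfs_level_pred[OF h] by (metis nat.distinct(1))
    with Suc show ?case by (metis Suc_inject rtrancl.rtrancl_into_rtrancl)
  qed
qed (use assms in auto)

context connected_graph
begin

lemma bfs_level_dist_from:
  assumes "R \<subseteq> pverts G" "R \<noteq> {}"
  shows "bfs_level G R (dist_from G R)"
proof -
  let ?P = "\<lambda>u k. \<exists>r\<in>R. (r, u) \<in> parcs G ^^ k"
  have ex: "\<exists>k. ?P u k" if "u \<in> pverts G" for u
    using assms reachable[OF _ that] rtrancl_imp_relpow by (metis ex_in_conv subsetD)
  have least: "?P u (dist_from G R u)" if "u \<in> pverts G" for u
    unfolding dist_from_def using ex[OF that] by (rule LeastI_ex)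
  have le: "dist_from G R u \<le> k" if "?P u k" for u k
    unfolding dist_from_def using that by (rule Least_le)
  show ?thesis
    unfolding bfs_level_def
  proof (intro conjI ballI allI impI)
    fix u assume "u \<in> pverts G"
    then show "dist_from G R u = 0 \<longleftrightarrow> u \<in> R"
      using least[of u] le[of u 0] by auto
  next
    fix u w assume uw: "(u, w) \<in> parcs G"
    then have "?P w (Suc (dist_from G R u))"
      using least[of u] arcs_wf by (meson relpow_Suc_I)
    then show "dist_from G R w \<le> Suc (dist_from G R u)" by (rule le)
  next
    fix w assume w: "w \<in> pverts G" "dist_from G R w \<noteq> 0"
    then obtain k where k: "dist_from G R w = Suc k" using not0_implies_Suc by blast
    with least[OF w(1)] obtain r u where r: "r \<in> R" "(r, u) \<in> parcs G ^^ k" "(u, w) \<in> parcs G"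
      by auto
    then have u: "u \<in> pverts G" and "dist_from G R u \<le> k" using arcs_wf le by blast+
    \<comment> \<open>The arc \<open>(u, w)\<close> ends a shortest walk to \<open>w\<close>. A
      shorter walk to \<open>u\<close> would shorten that walk, so \<open>u\<close> lies exactly one
      level below \<open>w\<close>.\<close>
    moreover have "Suc k \<le> Suc (dist_from G R u)"
      using least[OF u] r(3) le k by (metis relpow_Suc_I)
    ultimately show "\<exists>u\<in>pverts G. (u, w) \<in> parcs G \<and> dist_from G R w = Suc (dist_from G R u)"
      using r k by (intro bexI[of _ u]) auto
  qed
qed

lemma dist_from_eqI:
  assumes "v \<in> pverts G" "bfs_level G {v} h" "u \<in> pverts G"
  shows "dist_from G {v} u = h u"
  using bfs_level_unique[OF bfs_level_dist_from assms(2,3)] assms(1) by simp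

lemma stacking_cost_eqI:
  assumes "v \<in> pverts G" "bfs_level G {v} h"
  shows "stacking_cost G v = (\<Sum>u\<in>pverts G. 2 ^ h u)"
  unfolding stacking_cost_def using dist_from_eqI[OF assms] by simp

section \<open>Weights under pebbling steps and the cover pebbling theorem\<close>

text \<open>A smaller source set is farther away from every vertex. It must stay nonempty, because
  distances from the empty set are only default values.\<close>

lemma weight_mono:
  assumes "R' \<subseteq> R" "R' \<noteq> {}" "R \<subseteq> pverts G"
  shows "weight G R q \<le> weight G R' q"
  unfolding weight_def
proof (rule sum_mono)
  fix u assume "u \<in> pverts G"
  then have "dist_from G R u \<le> dist_from G R' u"
    using assms by (intro bfs_level_antimono[of G R _ R'] bfs_level_dist_from) auto
  then show "q u * 2 ^ dist_from G R u \<le> q u * 2 ^ dist_from G R' u" by simp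
qed

text \<open>The balance of one step, with the loss added on the left to avoid truncated subtraction.
  It is used with \<open>g\<close> a power of two of the distance, for weights, and with
  \<open>g = 1\<close>, for the number of pebbles.\<close>

lemma sum_pebbling_step:
  fixes g :: "'a \<Rightarrow> nat"
  assumes "(u, v) \<in> parcs G" "2 \<le> q u"
  shows "(\<Sum>x\<in>pverts G. (q(u := q u - 2, v := q v + 1)) x * g x) + 2 * g u
    = (\<Sum>x\<in>pverts G. q x * g x) + g v"
proof -
  have uv: "u \<in> pverts G" "v \<in> pverts G - {u}" "u \<noteq> v"
    using assms(1) arcs_wf loopfree by auto
  let ?q = "q(u := q u - 2, v := q v + 1)"
  have split: "(\<Sum>x\<in>pverts G. f x) = f u + (f v + (\<Sum>x\<in>pverts G - {u} - {v}. f x))"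
    for f :: "'a \<Rightarrow> nat"
    using uv finite_verts by (simp add: sum.remove)
  have "(\<Sum>x\<in>pverts G - {u} - {v}. ?q x * g x) = (\<Sum>x\<in>pverts G - {u} - {v}. q x * g x)"
    by (rule sum.cong) auto
  moreover have "(q u - 2) * g u + 2 * g u = q u * g u"
    using assms(2) by (metis add_mult_distrib le_add_diff_inverse2)
  ultimately show ?thesis
    using uv by (simp add: split algebra_simps)
qed

text \<open>The target of the step is at most one level higher than its source, so the new pebble
  weighs at most as much as the two removed.\<close>

lemma weight_pebbling_step_le:
  assumes "v \<in> pverts G" "pebbling_step G p q"
  shows "weight G {v} q \<le> weight G {v} p"
proof -
  obtain u w where uw: "(u, w) \<in> parcs G" "2 \<le> p u" "q = p(u := p u - 2, w := p w + 1)"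
    using assms(2) unfolding pebbling_step_def by blast
  let ?h = "dist_from G {v}"
  have "?h w \<le> Suc (?h u)"
    using bfs_level_step[OF bfs_level_dist_from uw(1)] assms(1) by simp
  then have "(2::nat) ^ ?h w \<le> 2 * 2 ^ ?h u"
    by (metis one_le_numeral power_Suc power_increasing)
  then show ?thesis
    using sum_pebbling_step[OF uw(1), of p "\<lambda>x. 2 ^ ?h x"] uw(2) unfolding weight_def uw(3)
    by simp
qed

lemma stacked_placement_needs_cost:
  assumes v: "v \<in> pverts G" and "(pebbling_step G)\<^sup>*\<^sup>* ((\<lambda>_. 0)(v := N)) q"
    and cover: "\<forall>u\<in>pverts G. 1 \<le> q u"
  shows "stacking_cost G v \<le> N"
proof -
  have "stacking_cost G v \<le> weight G {v} q"
    unfolding stacking_cost_def weight_def using cover by (intro sum_mono) simp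
  also have "\<dots> \<le> weight G {v} ((\<lambda>_. 0)(v := N))"
    using assms(2) by induction (use weight_pebbling_step_le[OF v] in force)+
  also have "\<dots> = N"
  proof -
    have "dist_from G {v} v = 0"
      using bfs_level_zero[OF bfs_level_dist_from] v by simp
    then show ?thesis
      unfolding weight_def using v finite_verts by (simp add: sum.remove[of _ v])
  qed
  finally show ?thesis .
qed

text \<open>The vertices between \<open>R\<close> and \<open>t\<close> may give up their only pebble; they then become empty
  vertices closer to \<open>R\<close>.\<close>

lemma carry_pebble:
  assumes R: "R \<subseteq> pverts G" "R \<noteq> {}" and fat: "\<forall>u\<in>R. 2 \<le> q u"
    and "t \<in> pverts G"
    and "\<forall>u\<in>pverts G. dist_from G R u < dist_from G R t \<longrightarrow> 1 \<le> q u"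
  shows "\<exists>q'. (pebbling_step G)\<^sup>*\<^sup>* q q' \<and> q' t = q t + min 1 (dist_from G R t) \<and>
    (\<forall>u. u \<noteq> t \<longrightarrow> q' u \<le> q u) \<and>
    (\<forall>u. u \<noteq> t \<longrightarrow> dist_from G R t \<le> dist_from G R u \<longrightarrow> q' u = q u) \<and>
    weight G R q' = weight G R q \<and>
    (\<Sum>u\<in>pverts G. q' u) + dist_from G R t = (\<Sum>u\<in>pverts G. q u)"
  using assms(4,5)
\<comment> \<open>A pebble is first delivered to a predecessor \<open>u\<close> of \<open>t\<close>
  and then moved on. The term \<open>min 1\<close> covers targets in \<open>R\<close>, where nothing
  is moved.\<close>
proof (induction "dist_from G R t" arbitrary: t)
  case 0
  then show ?case by (intro exI[of _ q]) auto
next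
  case (Suc k)
  note level = bfs_level_dist_from[OF R]
  let ?h = "dist_from G R"
  obtain u where u: "u \<in> pverts G" "(u, t) \<in> parcs G" "?h t = Suc (?h u)"
    using bfs_level_pred[OF level Suc.prems(1)] Suc.hyps(2) by auto
  then have "\<forall>w\<in>pverts G. ?h w < ?h u \<longrightarrow> 1 \<le> q w" using Suc.prems(2) by auto
  with Suc.hyps(1)[of u] u Suc.hyps(2) obtain q1 where
    steps: "(pebbling_step G)\<^sup>*\<^sup>* q q1" and q1u: "q1 u = q u + min 1 (?h u)"
    and le: "\<And>w. w \<noteq> u \<Longrightarrow> q1 w \<le> q w"
    and eq: "\<And>w. w \<noteq> u \<Longrightarrow> ?h u \<le> ?h w \<Longrightarrow> q1 w = q w"
    and wt: "weight G R q1 = weight G R q"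
    and size: "(\<Sum>u\<in>pverts G. q1 u) + ?h u = (\<Sum>u\<in>pverts G. q u)"
    by auto
  have ut: "u \<noteq> t" using u(3) by auto
  \<comment> \<open>Either \<open>u\<close> lies in \<open>R\<close>, or it held a pebble and has
    just received another.\<close>
  have "2 \<le> q1 u"
  proof (cases "?h u = 0")
    case True
    then show ?thesis using fat bfs_level_zero[OF level u(1)] q1u by auto
  next
    case False
    then show ?thesis using Suc.prems(2) u(1,3) q1u by fastforce
  qed
  define q2 where "q2 = q1(u := q1 u - 2, t := q1 t + 1)"
  have "pebbling_step G q1 q2"
    unfolding pebbling_step_def q2_def using u(2) \<open>2 \<le> q1 u\<close> by blast
  \<comment> \<open>Weight is preserved exactly because \<open>t\<close> is exactly one level above
    \<open>u\<close>.\<close>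
  moreover have "weight G R q2 = weight G R q1"
    using sum_pebbling_step[OF u(2), of q1 "\<lambda>x. 2 ^ ?h x"] \<open>2 \<le> q1 u\<close> u(3)
    unfolding weight_def q2_def by simp
  moreover have "(\<Sum>x\<in>pverts G. q2 x) + 1 = (\<Sum>x\<in>pverts G. q1 x)"
    using sum_pebbling_step[OF u(2), of q1 "\<lambda>x. 1"] \<open>2 \<le> q1 u\<close> unfolding q2_def by simp
  \<comment> \<open>Since \<open>t\<close> lies above \<open>u\<close>, the delivery to
    \<open>u\<close> has not touched it.\<close>
  moreover have "q2 t = q t + 1" using eq[of t] ut u(3) by (simp add: q2_def)
  moreover have "q2 w \<le> q w" if "w \<noteq> t" for w
    using that le[of w] q1u by (auto simp: q2_def)
  moreover have "q2 w = q w" if "w \<noteq> t" "?h t \<le> ?h w" for w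
    using that eq[of w] u(3) by (auto simp: q2_def)
  ultimately show ?case
    using steps wt size u(3) by (intro exI[of _ q2]) auto
qed

text \<open>Here \<open>R\<close> only has to contain the vertices with at least two pebbles. Each
  round replaces it by the exact set \<open>F\<close> of these vertices; if \<open>F\<close> is
  empty, the old \<open>R\<close> still supplies a vertex for the contradiction.\<close>

lemma cover_if_weight_ge_costs:
  assumes "R \<subseteq> pverts G" "R \<noteq> {}" "\<forall>u\<in>pverts G - R. q u \<le> 1"
    and "\<forall>v\<in>pverts G. stacking_cost G v \<le> weight G R q"
  shows "\<exists>q'. (pebbling_step G)\<^sup>*\<^sup>* q q' \<and> (\<forall>v\<in>pverts G. 1 \<le> q' v)"
  using assms
proof (induction "\<Sum>u\<in>pverts G. q u" arbitrary: q R rule: less_induct)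
  case less
  define F where "F = {u \<in> pverts G. 2 \<le> q u}"
  have F: "F \<subseteq> R" "F \<subseteq> pverts G" using less.prems(3) unfolding F_def by force+
  show ?case
  proof (cases "\<forall>v\<in>pverts G. 1 \<le> q v")
    case True
    then show ?thesis by blast
  next
    case False
    then obtain t0 where t0: "t0 \<in> pverts G" "q t0 = 0" by force
    show ?thesis
    proof (cases "F = {}")
      case True
      then have q1: "q u \<le> 1" if "u \<in> pverts G" for u
        using that unfolding F_def by (auto simp: not_le)
      obtain r where r: "r \<in> R" using less.prems(2) by blast
      have "weight G R q \<le> weight G {r} q"
        using r less.prems(1) by (intro weight_mono) auto
      \<comment> \<open>No vertex has more than one pebble and \<open>t0\<close> has none, so the
        inequality is strict at \<open>t0\<close>.\<close>
      also have "\<dots> < stacking_cost G r"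
        unfolding weight_def stacking_cost_def
      proof (rule sum_strict_mono_ex1)
        show "\<forall>u\<in>pverts G. q u * 2 ^ dist_from G {r} u \<le> 2 ^ dist_from G {r} u"
          using q1 by (auto intro: mult_le_mono1[of _ 1, simplified])
        show "\<exists>u\<in>pverts G. q u * 2 ^ dist_from G {r} u < 2 ^ dist_from G {r} u"
          using t0 by (intro bexI[of _ t0]) auto
      qed (rule finite_verts)
      finally show ?thesis using less.prems(1,4) r by fastforce
    next
      case nonempty: False
      let ?h = "dist_from G F"
      obtain t where t: "t \<in> pverts G" "q t = 0"
        and closest: "\<And>u. u \<in> pverts G \<Longrightarrow> q u = 0 \<Longrightarrow> ?h t \<le> ?h u"
        using ex_has_least_nat[of "\<lambda>u. u \<in> pverts G \<and> q u = 0" t0 ?h] t0 by blast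
      have "\<forall>u\<in>pverts G. ?h u < ?h t \<longrightarrow> 1 \<le> q u"
        using closest by (metis leD less_one not_le)
      moreover have "\<forall>u\<in>F. 2 \<le> q u" by (simp add: F_def)
      ultimately obtain q' where steps: "(pebbling_step G)\<^sup>*\<^sup>* q q'"
        and q't: "q' t = q t + min 1 (?h t)"
        and le: "\<And>u. u \<noteq> t \<Longrightarrow> q' u \<le> q u"
        and wt: "weight G F q' = weight G F q"
        and size: "(\<Sum>u\<in>pverts G. q' u) + ?h t = (\<Sum>u\<in>pverts G. q u)"
        using carry_pebble[OF F(2) nonempty _ t(1), of q] by auto
      \<comment> \<open>An empty vertex is not in \<open>F\<close>. Hence carrying a pebble to it
        lowers the total number of pebbles, which is the induction measure.\<close>
      have "?h t \<noteq> 0"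
        using bfs_level_zero[OF bfs_level_dist_from[OF F(2) nonempty] t(1)] t(2)
        by (auto simp: F_def)
      \<comment> \<open>The empty vertex \<open>t\<close> ends with one pebble and all others can
        only lose, so \<open>F\<close> can serve as the next \<open>R\<close>.\<close>
      have thin: "\<forall>u\<in>pverts G - F. q' u \<le> 1"
      proof
        fix u assume "u \<in> pverts G - F"
        then show "q' u \<le> 1"
          using le[of u] q't t(2) by (cases "u = t") (auto simp: F_def)
      qed
      have "weight G R q \<le> weight G F q'"
        using weight_mono[OF F(1) nonempty less.prems(1), of q] wt by simp
      with less.prems(4) have "\<forall>v\<in>pverts G. stacking_cost G v \<le> weight G F q'"
        using le_trans by blast
      with less.hyps[of q' F] size \<open>?h t \<noteq> 0\<close> F(2) nonempty thin
      obtain q'' where "(pebbling_step G)\<^sup>*\<^sup>* q' q''" "\<forall>v\<in>pverts G. 1 \<le> q'' v"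
        by auto
      then show ?thesis using steps by (meson rtranclp_trans)
    qed
  qed
qed

theorem cover_pebbling_number_eq_Max_stacking_cost:
  "cover_pebbling_number G = Max (stacking_cost G ` pverts G)"
  unfolding cover_pebbling_number_def
proof (rule Least_equality)
  show "\<forall>p. placement G (Max (stacking_cost G ` pverts G)) p \<longrightarrow>
    (\<exists>q. (pebbling_step G)\<^sup>*\<^sup>* p q \<and> (\<forall>v\<in>pverts G. 1 \<le> q v))"
  proof (intro allI impI)
    fix p assume p: "placement G (Max (stacking_cost G ` pverts G)) p"
    \<comment> \<open>With all vertices as the source set every distance is 0, so the initial weight
      is the number of pebbles.\<close>
    have "weight G (pverts G) p = (\<Sum>v\<in>pverts G. p v)"
      unfolding weight_def
      using bfs_level_zero[OF bfs_level_dist_from[OF order.refl verts_nonempty]]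
      by (intro sum.cong) auto
    with p have "weight G (pverts G) p = Max (stacking_cost G ` pverts G)"
      unfolding placement_def by simp
    then show "\<exists>q. (pebbling_step G)\<^sup>*\<^sup>* p q \<and> (\<forall>v\<in>pverts G. 1 \<le> q v)"
      using verts_nonempty finite_verts by (intro cover_if_weight_ge_costs[of "pverts G"]) auto
  qed
next
  fix N assume N: "\<forall>p. placement G N p \<longrightarrow>
    (\<exists>q. (pebbling_step G)\<^sup>*\<^sup>* p q \<and> (\<forall>v\<in>pverts G. 1 \<le> q v))"
  have "stacking_cost G v \<le> N" if v: "v \<in> pverts G" for v
  proof -
    have "placement G N ((\<lambda>_. 0)(v := N))"
      unfolding placement_def using v finite_verts by (auto simp: sum.remove[of _ v])
    with N stacked_placement_needs_cost[OF v] show ?thesis by blast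
  qed
  then show "Max (stacking_cost G ` pverts G) \<le> N"
    using finite_verts verts_nonempty by simp
qed

end


section \<open>Cartesian products\<close>

text \<open>An arc changes only one coordinate, so the sum rises by at most one. If the sum is
  positive, some summand is, and a predecessor in that coordinate lowers it.\<close>

lemma bfs_level_cartesian_product:
  assumes "bfs_level G {a} h" "bfs_level H {b} k"
  shows "bfs_level (G \<box> H) {(a, b)} (\<lambda>(x, y). h x + k y)"
  unfolding bfs_level_def
proof (intro conjI ballI allI impI)
  fix u assume "u \<in> pverts (G \<box> H)"
  then show "(case u of (x, y) \<Rightarrow> h x + k y) = 0 \<longleftrightarrow> u \<in> {(a, b)}"
    using assms by (auto simp: cartesian_product_def bfs_level_zero)
next
  fix u w assume "(u, w) \<in> parcs (G \<box> H)"
  then show "(case w of (x, y) \<Rightarrow> h x + k y) \<le> Suc (case u of (x, y) \<Rightarrow> h x + k y)"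
    by (auto simp: cartesian_product_def dest: bfs_level_step[OF assms(1)] bfs_level_step[OF assms(2)])
next
  fix w assume w: "w \<in> pverts (G \<box> H)" "(case w of (x, y) \<Rightarrow> h x + k y) \<noteq> 0"
  obtain x y where xy: "w = (x, y)" "x \<in> pverts G" "y \<in> pverts H"
    using w(1) by (auto simp: cartesian_product_def)
  consider "h x \<noteq> 0" | "k y \<noteq> 0" using w(2) xy(1) by auto
  then show "\<exists>u\<in>pverts (G \<box> H). (u, w) \<in> parcs (G \<box> H) \<and>
      (case w of (x, y) \<Rightarrow> h x + k y) = Suc (case u of (x, y) \<Rightarrow> h x + k y)"
  proof cases
    case 1
    with bfs_level_pred[OF assms(1) xy(2)] obtain x' where
      "x' \<in> pverts G" "(x', x) \<in> parcs G" "h x = Suc (h x')" by blast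
    then show ?thesis using xy by (intro bexI[of _ "(x', y)"]) (auto simp: cartesian_product_def)
  next
    case 2
    with bfs_level_pred[OF assms(2) xy(3)] obtain y' where
      "y' \<in> pverts H" "(y', y) \<in> parcs H" "k y = Suc (k y')" by blast
    then show ?thesis using xy by (intro bexI[of _ "(x, y')"]) (auto simp: cartesian_product_def)
  qed
qed

lemma connected_graph_cartesian_product:
  assumes "connected_graph G" "connected_graph H"
  shows "connected_graph (G \<box> H)"
proof -
  interpret G: connected_graph G by fact
  interpret H: connected_graph H by fact
  show ?thesis
  proof (rule connected_graphI_bfs)
    fix v assume "v \<in> pverts (G \<box> H)"
    then obtain a b where "v = (a, b)" "a \<in> pverts G" "b \<in> pverts H"
      by (auto simp: cartesian_product_def)
    then show "\<exists>h. bfs_level (G \<box> H) {v} h"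
      using bfs_level_cartesian_product[OF G.bfs_level_dist_from H.bfs_level_dist_from, of a b]
      by auto
  qed (use G.finite_verts G.verts_nonempty H.finite_verts H.verts_nonempty
      in \<open>auto simp: cartesian_product_def dest: G.arcs_wf H.arcs_wf G.loopfree H.loopfree\<close>)
qed

lemma Max_image_times_nat:
  fixes f :: "'a \<Rightarrow> nat" and g :: "'b \<Rightarrow> nat"
  assumes "finite A" "A \<noteq> {}" "finite B" "B \<noteq> {}"
  shows "Max ((\<lambda>(x, y). f x * g y) ` (A \<times> B)) = Max (f ` A) * Max (g ` B)"
proof (rule Max_eqI)
  have "Max (f ` A) \<in> f ` A" "Max (g ` B) \<in> g ` B" using assms by auto
  then show "Max (f ` A) * Max (g ` B) \<in> (\<lambda>(x, y). f x * g y) ` (A \<times> B)" by force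
qed (use assms in \<open>auto intro!: mult_le_mono\<close>)

theorem cover_pebbling_number_cartesian_product:
  assumes "connected_graph G" "connected_graph H"
  shows "cover_pebbling_number (G \<box> H) = cover_pebbling_number G * cover_pebbling_number H"
proof -
  interpret G: connected_graph G by fact
  interpret H: connected_graph H by fact
  interpret P: connected_graph "G \<box> H"
    using assms by (rule connected_graph_cartesian_product)
  have verts: "pverts (G \<box> H) = pverts G \<times> pverts H" by (simp add: cartesian_product_def)
  have "stacking_cost (G \<box> H) (a, b) = stacking_cost G a * stacking_cost H b"
    if "a \<in> pverts G" "b \<in> pverts H" for a b
  proof -
    let ?h = "dist_from G {a}" and ?k = "dist_from H {b}"
    have "bfs_level (G \<box> H) {(a, b)} (\<lambda>(x, y). ?h x + ?k y)"
      using that by (intro bfs_level_cartesian_product G.bfs_level_dist_from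
          H.bfs_level_dist_from) auto
    \<comment> \<open>Powers of two turn the added distances into products, so the double sum
      factors.\<close>
    then have "stacking_cost (G \<box> H) (a, b)
        = (\<Sum>(x, y)\<in>pverts G \<times> pverts H. 2 ^ ?h x * 2 ^ ?k y)"
      using that P.stacking_cost_eqI by (simp add: verts case_prod_unfold power_add)
    then show ?thesis
      by (simp add: stacking_cost_def sum_product sum.cartesian_product)
  qed
  then have "stacking_cost (G \<box> H) ` pverts (G \<box> H)
      = (\<lambda>(a, b). stacking_cost G a * stacking_cost H b) ` (pverts G \<times> pverts H)"
    unfolding verts by (intro image_cong) auto
  then show ?thesis
    using Max_image_times_nat[OF G.finite_verts G.verts_nonempty H.finite_verts H.verts_nonempty]
    by (simp add: G.cover_pebbling_number_eq_Max_stacking_cost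
        H.cover_pebbling_number_eq_Max_stacking_cost P.cover_pebbling_number_eq_Max_stacking_cost)
qed

section \<open>Relabelling and iterated products\<close>

text \<open>An injective relabelling is an isomorphism, and levels are pulled back along
  \<open>inv f\<close>. This is needed because iterated products rewrite pairs as lists.\<close>

lemma bfs_level_relabel:
  assumes "inj f" "bfs_level G {v} h"
  shows "bfs_level (relabel f G) {f v} (\<lambda>x. h (inv f x))"
  unfolding bfs_level_def
proof (intro conjI ballI allI impI)
  fix u assume "u \<in> pverts (relabel f G)"
  then show "h (inv f u) = 0 \<longleftrightarrow> u \<in> {f v}"
    using assms by (auto simp: relabel_def bfs_level_zero inj_eq)
next
  fix u w assume "(u, w) \<in> parcs (relabel f G)"
  then show "h (inv f w) \<le> Suc (h (inv f u))"
    using assms by (auto simp: relabel_def bfs_level_step)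
next
  fix w assume w: "w \<in> pverts (relabel f G)" "h (inv f w) \<noteq> 0"
  then obtain y where y: "w = f y" "y \<in> pverts G" "h y \<noteq> 0"
    using assms(1) by (auto simp: relabel_def)
  with bfs_level_pred[OF assms(2)] obtain x where
    "x \<in> pverts G" "(x, y) \<in> parcs G" "h y = Suc (h x)" by blast
  then show "\<exists>u\<in>pverts (relabel f G). (u, w) \<in> parcs (relabel f G) \<and>
      h (inv f w) = Suc (h (inv f u))"
    using y assms(1) by (intro bexI[of _ "f x"]) (force simp: relabel_def)+
qed

lemma connected_graph_relabel:
  assumes "inj f" "connected_graph G"
  shows "connected_graph (relabel f G)"
proof -
  interpret G: connected_graph G by fact
  show ?thesis
  proof (rule connected_graphI_bfs)
    fix v assume "v \<in> pverts (relabel f G)"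
    then obtain a where "v = f a" "a \<in> pverts G" by (auto simp: relabel_def)
    then show "\<exists>h. bfs_level (relabel f G) {v} h"
      using bfs_level_relabel[OF assms(1) G.bfs_level_dist_from, of a] by auto
  qed (use G.finite_verts G.verts_nonempty G.arcs_wf G.loopfree assms(1)
      in \<open>auto simp: relabel_def inj_eq\<close>)
qed

lemma cover_pebbling_number_relabel:
  assumes "inj f" "connected_graph G"
  shows "cover_pebbling_number (relabel f G) = cover_pebbling_number G"
proof -
  interpret G: connected_graph G by fact
  interpret R: connected_graph "relabel f G"
    using assms by (rule connected_graph_relabel)
  have verts: "pverts (relabel f G) = f ` pverts G" by (simp add: relabel_def)
  have "stacking_cost (relabel f G) (f v) = stacking_cost G v" if "v \<in> pverts G" for v
  proof -
    have "bfs_level (relabel f G) {f v} (\<lambda>x. dist_from G {v} (inv f x))"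
      using that assms(1) by (intro bfs_level_relabel G.bfs_level_dist_from) auto
    then have "stacking_cost (relabel f G) (f v)
        = (\<Sum>u\<in>f ` pverts G. 2 ^ dist_from G {v} (inv f u))"
      using that R.stacking_cost_eqI by (simp add: verts)
    then show ?thesis
      using assms(1) by (simp add: stacking_cost_def sum.reindex inj_on_subset)
  qed
  then have "stacking_cost (relabel f G) ` pverts (relabel f G) = stacking_cost G ` pverts G"
    unfolding verts image_image by (intro image_cong) auto
  then show ?thesis
    by (simp add: G.cover_pebbling_number_eq_Max_stacking_cost
        R.cover_pebbling_number_eq_Max_stacking_cost)
qed

lemma
  assumes "\<forall>G\<in>set Gs. connected_graph G"
  shows connected_graph_cartesian_product_list: "connected_graph (cartesian_product_list Gs)"
    and cover_pebbling_number_cartesian_product_list: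
      "cover_pebbling_number (cartesian_product_list Gs) = (\<Prod>G\<leftarrow>Gs. cover_pebbling_number G)"
  using assms
proof (induction Gs)
  case Nil
  let ?G = "\<lparr>pverts = {[]}, parcs = {}\<rparr> :: 'a list pair_pre_digraph"
  \<comment> \<open>The one-vertex graph has stacking cost \<open>2 ^ 0 = 1\<close>, the value of
    the empty product.\<close>
  have level: "bfs_level ?G {[]} (\<lambda>_. 0)" by (simp add: bfs_level_def)
  interpret connected_graph ?G
    by (rule connected_graphI_bfs) (use level in auto)
  { case 1 show ?case by (simp add: connected_graph_axioms) }
  { case 2 show ?case
      using cover_pebbling_number_eq_Max_stacking_cost stacking_cost_eqI[OF _ level] by simp }
next
  case (Cons G Gs)
  have inj: "inj (\<lambda>(x, xs). x # xs)" by (auto intro: injI)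
  { case 1
    with Cons.IH show ?case
      by (simp add: connected_graph_relabel inj connected_graph_cartesian_product) }
  { case 2
    with Cons.IH show ?case
      by (simp add: cover_pebbling_number_relabel inj connected_graph_cartesian_product
          cover_pebbling_number_cartesian_product) }
qed

section \<open>Paths\<close>

text \<open>One of the two truncated differences is always 0, so their sum is the absolute
  difference. The predecessor of \<open>w\<close> is its neighbour on the side of
  \<open>v\<close>.\<close>

lemma bfs_level_path_graph:
  assumes "v < n"
  shows "bfs_level (path_graph n) {v} (\<lambda>u. (u - v) + (v - u))"
  unfolding bfs_level_def
proof (intro conjI ballI allI impI)
  fix w assume w: "w \<in> pverts (path_graph n)" "(w - v) + (v - w) \<noteq> 0"
  show "\<exists>u\<in>pverts (path_graph n). (u, w) \<in> parcs (path_graph n) \<and>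
      (w - v) + (v - w) = Suc ((u - v) + (v - u))"
  proof (cases "v < w")
    case True
    then show ?thesis using w by (intro bexI[of _ "w - 1"]) (auto simp: path_graph_def)
  next
    case False
    then show ?thesis using w assms by (intro bexI[of _ "Suc w"]) (auto simp: path_graph_def)
  qed
qed (auto simp: path_graph_def)

lemma connected_graph_path_graph:
  assumes "1 \<le> n"
  shows "connected_graph (path_graph n)"
proof (rule connected_graphI_bfs)
  fix v assume "v \<in> pverts (path_graph n)"
  then show "\<exists>h. bfs_level (path_graph n) {v} h"
    using bfs_level_path_graph by (auto simp: path_graph_def)
qed (use assms in \<open>auto simp: path_graph_def lessThan_empty_iff\<close>)

text \<open>The worst stacks are at the ends. For \<open>v = n\<close> the sum is a reversed
  geometric series; otherwise the added vertex \<open>n\<close> contributes at most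
  \<open>2 ^ n\<close> to a sum bounded by induction.\<close>

lemma sum_power2_dist_le:
  "v < n \<Longrightarrow> (\<Sum>u<n. (2::nat) ^ ((u - v) + (v - u))) \<le> 2 ^ n - 1"
proof (induction n)
  case (Suc n)
  show ?case
  proof (cases "v = n")
    case True
    have "(\<Sum>u<Suc n. (2::nat) ^ ((u - v) + (v - u))) = (\<Sum>u<Suc n. 2 ^ (Suc n - Suc u))"
      using True by (intro sum.cong) auto
    also have "\<dots> = (\<Sum>u<Suc n. 2 ^ u)" by (rule sum.nat_diff_reindex)
    finally show ?thesis by (simp only: sum_power2 lessThan_atLeast0 order.refl)
  next
    case False
    then have "(\<Sum>u<n. (2::nat) ^ ((u - v) + (v - u))) \<le> 2 ^ n - 1" using Suc by simp
    moreover have "(2::nat) ^ (n - v + (v - n)) \<le> 2 ^ n"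
      using Suc.prems by (intro power_increasing) auto
    moreover have "(1::nat) \<le> 2 ^ n" by simp
    ultimately show ?thesis unfolding sum.lessThan_Suc power_Suc by linarith
  qed
qed simp

lemma cover_pebbling_number_path_graph:
  assumes "1 \<le> n"
  shows "cover_pebbling_number (path_graph n) = 2 ^ n - 1"
proof -
  interpret connected_graph "path_graph n" using assms by (rule connected_graph_path_graph)
  have verts: "pverts (path_graph n) = {..<n}" by (simp add: path_graph_def)
  have cost: "stacking_cost (path_graph n) v = (\<Sum>u<n. 2 ^ ((u - v) + (v - u)))" if "v < n" for v
    using stacking_cost_eqI[OF _ bfs_level_path_graph[OF that]] that by (simp add: verts)
  have "Max (stacking_cost (path_graph n) ` {..<n}) = 2 ^ n - 1"
  proof (rule Max_eqI)
    \<comment> \<open>From the end vertex 0 the distances are \<open>0, ..., n - 1\<close>, so the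
      bound is attained.\<close>
    have "stacking_cost (path_graph n) 0 = 2 ^ n - 1"
      using assms by (simp add: cost sum_power2 lessThan_atLeast0)
    then show "2 ^ n - 1 \<in> stacking_cost (path_graph n) ` {..<n}"
      using assms by (metis image_eqI lessThan_iff less_le_trans zero_less_one)
  qed (auto simp: cost sum_power2_dist_le simp del: One_nat_def)
  then show ?thesis by (simp add: cover_pebbling_number_eq_Max_stacking_cost verts)
qed

section \<open>Cycles\<close>

text \<open>For \<open>u, v < m\<close> this is \<open>u - v\<close> modulo \<open>m\<close>: the
  number of forward steps from \<open>v\<close> to \<open>u\<close>.\<close>

definition cycle_offset :: "nat \<Rightarrow> nat \<Rightarrow> nat \<Rightarrow> nat" where
  "cycle_offset m v u = (if v \<le> u then u - v else u + m - v)"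

text \<open>The distance is the shorter of the two ways round. At \<open>u = v\<close> the offset is
  0, so the minimum vanishes.\<close>

lemma bfs_level_cycle_graph:
  assumes "v < m" "3 \<le> m"
  shows "bfs_level (cycle_graph m) {v} (\<lambda>u. min (cycle_offset m v u) (m - cycle_offset m v u))"
    (is "bfs_level _ _ ?h")
  unfolding bfs_level_def
proof (intro conjI ballI allI impI)
  fix u assume "u \<in> pverts (cycle_graph m)"
  then show "?h u = 0 \<longleftrightarrow> u \<in> {v}"
    using assms by (auto simp: cycle_graph_def cycle_offset_def min_def)
next
  fix u w assume "(u, w) \<in> parcs (cycle_graph m)"
  then have "u < m" "w < m"
    and "w = (if Suc u = m then 0 else Suc u) \<or> u = (if Suc w = m then 0 else Suc w)"
    by (auto simp: cycle_graph_def mod_Suc split: if_splits)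
  then show "?h w \<le> Suc (?h u)"
    using assms unfolding cycle_offset_def by (auto split: if_splits)
next
  fix w assume "w \<in> pverts (cycle_graph m)" and h: "?h w \<noteq> 0"
  then have w: "w < m" by (simp add: cycle_graph_def)
  let ?k = "cycle_offset m v w"
  show "\<exists>u\<in>pverts (cycle_graph m). (u, w) \<in> parcs (cycle_graph m) \<and> ?h w = Suc (?h u)"
  proof (cases "?k \<le> m - ?k")
    case True
    \<comment> \<open>The forward way is shortest, so the predecessor is one step back,
      cyclically.\<close>
    define u where "u = (if w = 0 then m - 1 else w - 1)"
    have "u < m" "Suc u mod m = w" using w assms by (auto simp: u_def)
    moreover have "?k = Suc (cycle_offset m v u)"
      using h w assms by (auto simp: u_def cycle_offset_def split: if_splits)
    ultimately show ?thesis
      using True w by (intro bexI[of _ u]) (auto simp: cycle_graph_def)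
  next
    case False
    \<comment> \<open>The backward way is shorter, so the predecessor is one step ahead. If this is
      \<open>v\<close>, the offset drops to 0 rather than reaching \<open>m\<close>, but the minimum
      is 0 either way.\<close>
    define u where "u = (if Suc w = m then 0 else Suc w)"
    have u: "u < m" "u = Suc w mod m" using w assms by (auto simp: u_def)
    moreover have "?h w = Suc (?h u)"
      using h w assms False by (auto simp: u_def cycle_offset_def min_def split: if_splits)
    ultimately show ?thesis
      using w by (intro bexI[of _ u]) (auto simp: cycle_graph_def)
  qed
qed

lemma connected_graph_cycle_graph:
  assumes "3 \<le> m"
  shows "connected_graph (cycle_graph m)"
proof (rule connected_graphI_bfs)
  fix v assume "v \<in> pverts (cycle_graph m)"
  then show "\<exists>h. bfs_level (cycle_graph m) {v} h"
    using bfs_level_cycle_graph assms by (auto simp: cycle_graph_def)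
qed (use assms in \<open>auto simp: cycle_graph_def lessThan_empty_iff mod_Suc split: if_splits\<close>)

text \<open>The bounds say that \<open>r\<close> is \<open>m / 2\<close> rounded up. Offsets up to
  \<open>m - r\<close> have exponent \<open>k\<close>; the remaining ones have exponents
  \<open>r - 1, ..., 1\<close>. This gives two geometric series, the second without its term
  1.\<close>

lemma sum_power2_min_diff:
  assumes "1 \<le> r" "m \<le> 2 * r" "2 * r \<le> m + 1"
  shows "(\<Sum>k<m. (2::nat) ^ min k (m - k)) = 2 ^ r + 2 ^ (m - r + 1) - 3"
proof -
  have "(\<Sum>k<m. (2::nat) ^ min k (m - k))
      = (\<Sum>k<m - r + 1. 2 ^ min k (m - k)) + (\<Sum>k=m - r + 1..<m. 2 ^ min k (m - k))"
    using assms by (subst sum.union_disjoint[symmetric]) (auto intro!: sum.cong)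
  also have "(\<Sum>k<m - r + 1. (2::nat) ^ min k (m - k)) = (\<Sum>k<m - r + 1. 2 ^ k)"
    using assms by (intro sum.cong) auto
  also have "\<dots> = 2 ^ (m - r + 1) - 1" by (simp add: sum_power2 lessThan_atLeast0)
  also have "(\<Sum>k=m - r + 1..<m. (2::nat) ^ min k (m - k)) = (\<Sum>k=1..<r. 2 ^ k)"
    using assms by (intro sum.reindex_bij_witness[of _ "\<lambda>k. m - k" "\<lambda>k. m - k"]) auto
  also have "\<dots> = 2 ^ r - 2"
  proof -
    have "(\<Sum>k=0..<r. (2::nat) ^ k) = 1 + (\<Sum>k=1..<r. 2 ^ k)"
      using assms(1) by (simp add: sum.atLeast_Suc_lessThan)
    then show ?thesis by (simp add: sum_power2)
  qed
  finally show ?thesis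
    using power_increasing[of 1 r "2::nat"] power_increasing[of 1 "m - r + 1" "2::nat"] assms(1)
    by simp
qed

lemma cover_pebbling_number_cycle_graph:
  assumes m: "3 \<le> m"
  defines "r \<equiv> nat \<lceil>real m / 2\<rceil>"
  shows "cover_pebbling_number (cycle_graph m) = 2 ^ r + 2 ^ (m - r + 1) - 3"
proof -
  interpret connected_graph "cycle_graph m" using m by (rule connected_graph_cycle_graph)
  have verts: "pverts (cycle_graph m) = {..<m}" by (simp add: cycle_graph_def)
  have r: "1 \<le> r" "m \<le> 2 * r" "2 * r \<le> m + 1" using m unfolding r_def by linarith+
  have "stacking_cost (cycle_graph m) v = 2 ^ r + 2 ^ (m - r + 1) - 3" if "v < m" for v
  proof -
    have "stacking_cost (cycle_graph m) v
        = (\<Sum>u<m. 2 ^ min (cycle_offset m v u) (m - cycle_offset m v u))"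
      using stacking_cost_eqI[OF _ bfs_level_cycle_graph[OF that m]] that by (simp add: verts)
    \<comment> \<open>Rotation by \<open>v\<close> is inverse to \<open>cycle_offset m v\<close>, so
      all stacks cost the same and the maximum is over a single value.\<close>
    also have "\<dots> = (\<Sum>k<m. 2 ^ min k (m - k))"
      using that
      by (intro sum.reindex_bij_witness[of _ "\<lambda>k. if k + v < m then k + v else k + v - m"
            "cycle_offset m v"]) (auto simp: cycle_offset_def)
    also have "\<dots> = 2 ^ r + 2 ^ (m - r + 1) - 3" using r by (rule sum_power2_min_diff)
    finally show ?thesis .
  qed
  then have "stacking_cost (cycle_graph m) ` {..<m} = {2 ^ r + 2 ^ (m - r + 1) - 3}"
    using m by (auto simp: image_iff intro!: exI[of _ 0])
  then show ?thesis by (simp add: cover_pebbling_number_eq_Max_stacking_cost verts)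
qed

section \<open>Trees and complete graphs\<close>

text \<open>Connectedness of a digraph refers to the symmetric closure of its arcs; in a
  \<open>pair_graph\<close> the arcs are already symmetric.\<close>

lemma connected_graph_tree_graph:
  assumes "tree_graph T"
  shows "connected_graph T"
proof -
  interpret T: pair_graph T using assms by (simp add: tree_graph_def)
  have conn: "Digraph_Component.connected (with_proj T)" using assms by (simp add: tree_graph_def)
  have "(parcs T)\<^sup>s = parcs T" by (auto simp: symcl_def intro: T.arcs_symmetric)
  then have "(u, v) \<in> (parcs T)\<^sup>*" if "u \<in> pverts T" "v \<in> pverts T" for u v
    using conn that by (intro rtrancl_on_rtranclI[of _ _ "pverts T"]) (simp add: connected_conv)
  then show ?thesis
    using conn T.pair_finite_verts T.no_loops' T.wellformed'
    by unfold_locales (auto simp: connected_conv)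
qed

lemma connected_graph_complete_digraph:
  assumes "1 \<le> n" "complete_digraph n (with_proj K)"
  shows "connected_graph K"
proof
  fix u v assume "u \<in> pverts K" "v \<in> pverts K"
  then show "(u, v) \<in> (parcs K)\<^sup>*"
    using assms(2) by (cases "u = v") (auto simp: complete_digraph_pair_def)
qed (use assms in \<open>auto simp: complete_digraph_pair_def\<close>)

section \<open>The product formulas\<close>

theorem theorem4p5:
  fixes ns ms :: "nat list"
    and H :: "(nat list \<times> nat list) pair_pre_digraph"
  assumes paths: "\<forall>n\<in>set ns. n \<ge> 1"
    and cycles: "\<forall>m\<in>set ms. m \<ge> 3"
    and H: "H = cartesian_product_list (map path_graph ns)
                  \<box> cartesian_product_list (map cycle_graph ms)"
  shows "(cover_pebbling_number H
            = (\<Prod>n\<leftarrow>ns. cover_pebbling_number (path_graph n))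
              * (\<Prod>m\<leftarrow>ms. cover_pebbling_number (cycle_graph m))
          \<and> int (cover_pebbling_number (cartesian_product_list (map path_graph ns)))
            = (\<Prod>n\<leftarrow>ns. 2 ^ n - 1)
          \<and> int (cover_pebbling_number (cartesian_product_list (map cycle_graph ms)))
            = (\<Prod>m\<leftarrow>ms. let r = nat \<lceil>real m / 2\<rceil> in 2 ^ r + 2 ^ (m - r + 1) - 3))
       \<and> (\<forall>T :: 't pair_pre_digraph. tree_graph T \<longrightarrow>
            cover_pebbling_number (H \<box> T) = cover_pebbling_number H * cover_pebbling_number T)
       \<and> (\<forall>n \<ge> 1. \<forall>K :: 'k pair_pre_digraph. complete_digraph n (with_proj K) \<longrightarrow>
            cover_pebbling_number (H \<box> K) = cover_pebbling_number H * cover_pebbling_number K)"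
proof -
  have P: "\<forall>G\<in>set (map path_graph ns). connected_graph G"
    using paths connected_graph_path_graph by auto
  have C: "\<forall>G\<in>set (map cycle_graph ms). connected_graph G"
    using cycles connected_graph_cycle_graph by auto
  note conn = P[THEN connected_graph_cartesian_product_list]
    C[THEN connected_graph_cartesian_product_list]
  have conn_H: "connected_graph H"
    unfolding H using conn by (rule connected_graph_cartesian_product)
  have gamma_P: "cover_pebbling_number (cartesian_product_list (map path_graph ns))
      = (\<Prod>n\<leftarrow>ns. cover_pebbling_number (path_graph n))"
    using cover_pebbling_number_cartesian_product_list[OF P] by (simp add: comp_def)
  have gamma_C: "cover_pebbling_number (cartesian_product_list (map cycle_graph ms))
      = (\<Prod>m\<leftarrow>ms. cover_pebbling_number (cycle_graph m))"
    using cover_pebbling_number_cartesian_product_list[OF C] by (simp add: comp_def)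
  have "int (cover_pebbling_number (cartesian_product_list (map path_graph ns)))
      = (\<Prod>n\<leftarrow>ns. 2 ^ n - 1)"
    unfolding gamma_P using paths
    by (induction ns) (simp_all add: cover_pebbling_number_path_graph of_nat_diff)
  moreover have "int (cover_pebbling_number (cartesian_product_list (map cycle_graph ms)))
      = (\<Prod>m\<leftarrow>ms. let r = nat \<lceil>real m / 2\<rceil> in 2 ^ r + 2 ^ (m - r + 1) - 3)"
  proof -
    have "int (cover_pebbling_number (cycle_graph m))
        = (let r = nat \<lceil>real m / 2\<rceil> in 2 ^ r + 2 ^ (m - r + 1) - 3)" if "3 \<le> m" for m
    proof -
      define r where "r = nat \<lceil>real m / 2\<rceil>"
      have "1 \<le> r" using that unfolding r_def by linarith
      \<comment> \<open>The sum of powers is at least 4, so subtracting 3 in the naturals agrees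
        with subtracting it in the integers.\<close>
      then have "2 + 2 \<le> 2 ^ r + (2::nat) ^ (m - r + 1)"
        using power_increasing[of 1 r "2::nat"] power_increasing[of 1 "m - r + 1" "2::nat"]
        by (intro add_mono) auto
      then show ?thesis
        using cover_pebbling_number_cycle_graph[OF that]
        by (simp add: r_def[symmetric] Let_def of_nat_diff)
    qed
    then show ?thesis
      unfolding gamma_C using cycles by (induction ms) simp_all
  qed
  moreover have "cover_pebbling_number H
      = (\<Prod>n\<leftarrow>ns. cover_pebbling_number (path_graph n))
        * (\<Prod>m\<leftarrow>ms. cover_pebbling_number (cycle_graph m))"
    unfolding H cover_pebbling_number_cartesian_product[OF conn] gamma_P gamma_C ..
  moreover have "cover_pebbling_number (H \<box> T) = cover_pebbling_number H * cover_pebbling_number T"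
    if "tree_graph T" for T :: "'t pair_pre_digraph"
    using conn_H connected_graph_tree_graph[OF that]
    by (rule cover_pebbling_number_cartesian_product)
  moreover have "cover_pebbling_number (H \<box> K) = cover_pebbling_number H * cover_pebbling_number K"
    if "1 \<le> n" "complete_digraph n (with_proj K)" for n and K :: "'k pair_pre_digraph"
    using conn_H connected_graph_complete_digraph[OF that]
    by (rule cover_pebbling_number_cartesian_product)
  ultimately show ?thesis by blast
qed

end
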